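(* Let $\{g_{ij}^*\}_{(i,j)\in\mathcal{E}}$ be feasible bearing constraints that ensure infinitesimal bearing rigidity. Let $p(0)\in\mathbb{R}^{dn}$ be an initial configuration with associated target configuration $p^*$, and let $\gamma$ satisfy $0\le\gamma<\min_{i,j\in\mathcal{V},\,i\ne j}\|p_i^*-p_j^*\|$. If $$\|p(0)-p^*\|<\frac{1}{\sqrt n}\left(\min_{i,j\in\mathcal{V},\,i\neq j}\|p_i^*-p_j^*\|-\gamma\right),$$ then the solution $p(t)$ of $$\dot p_i(t)=-\sum_{j\in\mathcal{N}_i}P_{g_{ij}(t)}g_{ij}^*,\qquad i\in\mathcal{V},$$ with initial value $p(0)$ satisfies $\|p_i(t)-p_j(t)\|>\gamma$ for all $i,j\in\mathcal{V}$ with $i\ne j$ and all $t\ge0$.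
   Context: Let $n\ge2$, $d\ge 2$, and let $\mathcal{G}=(\mathcal{V},\mathcal{E})$ be a fixed undirected graph without self-loops, $\mathcal{V}=\{1,\dots,n\}$, with $m$ edges, neighbor sets $\mathcal{N}_i$. Agent $i$ has position $p_i\in\mathbb{R}^d$, $p=[p_1^{\mathrm T},\dots,p_n^{\mathrm T}]^{\mathrm T}$. For $(i,j)\in\mathcal{E}$, $e_{ij}=p_j-p_i$ and $g_{ij}=e_{ij}/\|e_{ij}\|$ (the bearing, defined when $p_i\neq p_j$). For nonzero $x\in\mathbb{R}^d$, $P_x=I_d-xx^{\mathrm T}/\|x\|^2$. $\mathbf 1=[1,\dots,1]^{\mathrm T}\in\mathbb{R}^n$. Bearing constraints are constant unit vectors $g_{ij}^*\in\mathbb{R}^d$, $(i,j)\in\mathcal{E}$, with $g_{ij}^*=-g_{ji}^*$. They are feasible if some configuration satisfies $g_{ij}=g_{ij}^*$ for all $(i,j)\in\mathcal{E}$. They ensure infinitesimal bearing rigidity if any formation $\mathcal{G}(q)$ satisfying them is infinitesimally bearing rigid, meaning: with $R(q)$ the Jacobian with respect to $q$ of the stacked bearing vector $[g_1^{\mathrm T},\dots,g_m^{\mathrm T}]^{\mathrm T}$ (one bearing per edge for an arbitrary orientation), every $\delta q$ with $R(q)\delta q=0$ has the form $\mathbf{1}\otimes x+\alpha q$, $x\in\mathbb{R}^d$, $\alpha\in\mathbb{R}$. The centroid and scale of $p$ are $\bar p=\frac1n\sum_i p_i$ and $s=\sqrt{\frac1n\sum_i\|p_i-\bar p\|^2}$.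 The target configuration $p^*$ associated with $p(0)$ (where $s(0)>0$) is the unique configuration with centroid $\bar p^*=\bar p(0)$, scale $s^*=s(0)$, and $(p_j^*-p_i^* )/\|p_j^*-p_i^*\|=g_{ij}^*$ for all $(i,j)\in\mathcal{E}$. *)

theory Defs
  imports "HOL-Analysis.Analysis"
begin

text \<open>
  A configuration of the agents \<open>'n\<close> in \<open>real ^ 'd\<close> has type \<open>(real ^ 'd) ^ 'n\<close>; its norm is the
  Euclidean norm of the stacked vector of positions. A graph on \<open>'n\<close> is a symmetric irreflexive
  edge relation, so each undirected edge occurs as two ordered pairs.
\<close>

definition orientation :: "('n \<times> 'n) set \<Rightarrow> ('n \<times> 'n) set \<Rightarrow> bool" where
  "orientation E Or \<longleftrightarrow> Or \<union> Or\<inverse> = E \<and> Or \<inter> Or\<inverse> = {}"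

text \<open>Meaningful only if \<open>p $ i \<noteq> p $ j\<close>; this is required explicitly wherever it is used.\<close>

definition bearing :: "(real ^ 'd) ^ 'n \<Rightarrow> 'n \<Rightarrow> 'n \<Rightarrow> real ^ 'd" where
  "bearing p i j = (p $ j - p $ i) /\<^sub>R norm (p $ j - p $ i)"

definition orth_proj :: "real ^ 'd \<Rightarrow> real ^ 'd ^ 'd" where
  "orth_proj x =
     mat 1 - (1 / (norm x)\<^sup>2) *\<^sub>R ((columnvector x :: real ^ 1 ^ 'd) ** (rowvector x :: real ^ 'd ^ 1))"

definition bearing_constraints :: "('n::finite \<times> 'n) set \<Rightarrow> ('n \<Rightarrow> 'n \<Rightarrow> real ^ 'd) \<Rightarrow> bool" where
  "bearing_constraints E gs \<longleftrightarrow> (\<forall>(i, j) \<in> E. norm (gs i j) = 1 \<and> gs i j = - gs j i)"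

definition satisfies_bearings ::
  "('n::finite \<times> 'n) set \<Rightarrow> ('n \<Rightarrow> 'n \<Rightarrow> real ^ 'd) \<Rightarrow> (real ^ 'd) ^ 'n \<Rightarrow> bool" where
  "satisfies_bearings E gs p \<longleftrightarrow> (\<forall>(i, j) \<in> E. p $ i \<noteq> p $ j \<and> bearing p i j = gs i j)"

definition feasible :: "('n::finite \<times> 'n) set \<Rightarrow> ('n \<Rightarrow> 'n \<Rightarrow> real ^ 'd) \<Rightarrow> bool" where
  "feasible E gs \<longleftrightarrow> (\<exists>p. satisfies_bearings E gs p)"

text \<open>
  The stacked vector has one block per oriented edge. Blocks are indexed by all ordered pairs of
  agents, and the blocks of pairs outside the orientation are identically zero.
\<close>

definition stacked_bearing :: "('n::finite \<times> 'n) set \<Rightarrow> (real ^ 'd) ^ 'n \<Rightarrow> (real ^ 'd) ^ ('n \<times> 'n)" where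
  "stacked_bearing Or p = (\<chi> e. if e \<in> Or then bearing p (fst e) (snd e) else 0)"

text \<open>
  The Jacobian of the stacked bearing vector at \<open>q\<close> is used as the linear map it represents,
  the Frechet derivative. The vector \<open>\<chi> i. x\<close> is the Kronecker product of the all-ones vector
  with \<open>x\<close>.
\<close>

definition inf_bearing_rigid :: "('n::finite \<times> 'n) set \<Rightarrow> (real ^ 'd) ^ 'n \<Rightarrow> bool" where
  "inf_bearing_rigid Or q \<longleftrightarrow>
     (\<forall>dq. frechet_derivative (stacked_bearing Or) (at q) dq = 0 \<longrightarrow>
        (\<exists>x \<alpha>. dq = (\<chi> i. x) + \<alpha> *\<^sub>R q))"

definition ensure_inf_bearing_rigidity ::
  "('n::finite \<times> 'n) set \<Rightarrow> ('n \<times> 'n) set \<Rightarrow> ('n \<Rightarrow> 'n \<Rightarrow> real ^ 'd) \<Rightarrow> bool" where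
  "ensure_inf_bearing_rigidity E Or gs \<longleftrightarrow>
     (\<forall>q. satisfies_bearings E gs q \<longrightarrow> inf_bearing_rigid Or q)"

definition centroid :: "(real ^ 'd) ^ 'n \<Rightarrow> real ^ 'd" where
  "centroid p = (1 / real CARD('n)) *\<^sub>R (\<Sum>i\<in>UNIV. p $ i)"

definition formation_scale :: "(real ^ 'd) ^ 'n \<Rightarrow> real" where
  "formation_scale p = sqrt ((1 / real CARD('n)) * (\<Sum>i\<in>UNIV. (norm (p $ i - centroid p))\<^sup>2))"

text \<open>
  Uniqueness of such \<open>ps\<close> is not part of the definition: it follows from infinitesimal bearing
  rigidity and positivity of the scale.
\<close>

definition target_configuration ::
  "('n::finite \<times> 'n) set \<Rightarrow> ('n \<Rightarrow> 'n \<Rightarrow> real ^ 'd) \<Rightarrow> (real ^ 'd) ^ 'n \<Rightarrow> (real ^ 'd) ^ 'n \<Rightarrow> bool" where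
  "target_configuration E gs p0 ps \<longleftrightarrow>
     centroid ps = centroid p0 \<and> formation_scale ps = formation_scale p0 \<and> satisfies_bearings E gs ps"

definition min_separation :: "(real ^ 'd) ^ 'n \<Rightarrow> real" where
  "min_separation p = Min {norm (p $ i - p $ j) | i j. i \<noteq> j}"

text \<open>
  A solution on \<open>J\<close> must keep neighbours apart on \<open>J\<close>, since the right-hand side is undefined
  when two neighbours coincide. At an endpoint of \<open>J\<close> the derivative is one-sided.
\<close>

definition bearing_solution_on ::
  "real set \<Rightarrow> ('n::finite \<times> 'n) set \<Rightarrow> ('n \<Rightarrow> 'n \<Rightarrow> real ^ 'd) \<Rightarrow> (real ^ 'd) ^ 'n \<Rightarrow>
   (real \<Rightarrow> (real ^ 'd) ^ 'n) \<Rightarrow> bool" where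
  "bearing_solution_on J E gs p0 p \<longleftrightarrow>
     p 0 = p0 \<and>
     (\<forall>t\<in>J. (\<forall>(i, j)\<in>E. p t $ i \<noteq> p t $ j) \<and>
       (\<forall>i. ((\<lambda>t. p t $ i) has_vector_derivative
               - (\<Sum>j\<in>E `` {i}. orth_proj (bearing (p t) i j) *v gs i j)) (at t within J)))"

end

theory Submission
  imports Defs
begin

text \<open>
  Since \<open>g\<^sub>i\<^sub>j\<close> is parallel to \<open>e\<^sub>i\<^sub>j\<close> and orthogonal to the range of its projection, pairing the two
  orientations of each edge gives, with \<open>p'\<close> the time derivative,
  \<open>(p - p\<^sup>*) \<bullet> p' = - (1/2) \<Sum> \<parallel>e\<^sup>*\<^sub>i\<^sub>j\<parallel> (1 - (g\<^sub>i\<^sub>j \<bullet> g\<^sup>*\<^sub>i\<^sub>j)\<^sup>2) \<le> 0\<close>, the sum over all ordered edges.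
  Hence the distance of a solution to the target never grows, and the distance between two
  agents differs from its target value by at most \<open>\<surd>2 \<parallel>p - p\<^sup>*\<parallel>\<close>. For existence, composing the vector field with the nearest-point
  projection onto a ball around \<open>p\<^sup>*\<close> on which neighbours stay apart makes it globally Lipschitz.
  The resulting field still does not point away from \<open>p\<^sup>*\<close>, so its global solution never leaves the
  ball and solves the original equation.
\<close>

section \<open>Global existence for Lipschitz fields on a half line\<close>

lemma integral_has_vector_derivative_at_least:
  fixes h :: "real \<Rightarrow> 'a::banach"
  assumes "continuous_on {a..} h" and "t \<ge> a"
  shows "((\<lambda>u. integral {a..u} h) has_vector_derivative h t) (at t within {a..})"
proof -
  have "continuous_on {a..t + 1} h"
    using assms(1) by (rule continuous_on_subset) auto
  \<comment> \<open>The extra unit keeps \<open>t\<close> away from the right endpoint, so the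
    derivative is two-sided for \<open>t > a\<close>.\<close>
  then have "((\<lambda>u. integral {a..u} h) has_vector_derivative h t) (at t within {a..t + 1})"
    using assms(2) by (intro integral_has_vector_derivative) auto
  moreover have "at t within {a..t + 1} = at t within {a..}"
    by (rule at_within_nhd[of _ "{..<t + 1}"]) auto
  ultimately show ?thesis by simp
qed

text \<open>Integrating \<open>exp (k * s)\<close> yields a factor \<open>1 / k\<close>, and the
  weight \<open>exp (- k * t)\<close> cancels the remaining growth, so the bound is uniform in
  \<open>t\<close>. It serves both the boundedness and the contraction of the Picard
  operator.\<close>

lemma norm_integral_le_exp:
  fixes h :: "real \<Rightarrow> 'a::banach"
  assumes "h integrable_on {0..t}" and "0 < k" and "0 \<le> C" and "0 \<le> t"
    and "\<And>s. s \<in> {0..t} \<Longrightarrow> norm (h s) \<le> C * exp (k * s)"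
  shows "exp (- k * t) * norm (integral {0..t} h) \<le> C / k"
proof -
  have I: "((\<lambda>s. C * exp (k * s)) has_integral (C / k * exp (k * t) - C / k * exp (k * 0))) {0..t}"
    using assms by (intro fundamental_theorem_of_calculus)
      (auto simp flip: has_real_derivative_iff_has_vector_derivative intro!: derivative_eq_intros)
  have "norm (integral {0..t} h) \<le> integral {0..t} (\<lambda>s. C * exp (k * s))"
    using assms I by (intro integral_norm_bound_integral) (auto simp: has_integral_integrable)
  also have "\<dots> \<le> C / k * exp (k * t)"
    using assms by (simp add: integral_unique[OF I] del: integral_mult_right)
  finally have "exp (- k * t) * norm (integral {0..t} h) \<le> exp (- k * t) * (C / k * exp (k * t))"
    by (intro mult_left_mono) auto
  also have "\<dots> = C / k" by (simp add: exp_minus field_simps)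
  finally show ?thesis .
qed

lemma global_solution_of_lipschitz_field:
  fixes F :: "'a::banach \<Rightarrow> 'a"
  assumes lip: "L-lipschitz_on UNIV F"
  obtains x where "x 0 = x0"
    and "\<And>t. t \<ge> 0 \<Longrightarrow> (x has_vector_derivative F (x t)) (at t within {0..})"
proof -
  \<comment> \<open>In the variable \<open>y t = exp (- k t) x t\<close> with \<open>k > L\<close>, the Picard operator contracts bounded functions
    on the whole half line at once, so no local solutions have to be glued.\<close>
  define k where "k = L + 1"
  have L: "0 \<le> L" using lip by (rule lipschitz_on_nonneg)
  have k: "0 < k" "L / k < 1" "0 \<le> L / k" using L by (auto simp: k_def field_simps)
  define h where "h y s = F (exp (k * s) *\<^sub>R apply_bcontfun y s)" for y :: "real \<Rightarrow>\<^sub>C 'a" and s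
  \<comment> \<open>Bounded continuous functions live on the whole real line, so
    \<open>max 0 t\<close> extends \<open>T y\<close> by the constant \<open>x0\<close> to negative
    times.\<close>
  define T where "T y t = exp (- k * max 0 t) *\<^sub>R (x0 + integral {0..max 0 t} (h y))" for y t
  have conth: "continuous_on S (h y)" for S y
    unfolding h_def
    by (rule continuous_on_compose2[OF lipschitz_on_continuous_on[OF lip]])
      (auto intro!: continuous_intros)
  have inth: "h y integrable_on {0..t}" for y t
    by (intro integrable_continuous_real conth)
  have der: "((\<lambda>u. integral {0..u} (h y)) has_vector_derivative h y t) (at t within {0..})"
    if "t \<ge> 0" for y t
    using conth that by (rule integral_has_vector_derivative_at_least)
  have "continuous_on UNIV (\<lambda>t. integral {0..max 0 t} (h y))" for y
  proof (rule continuous_on_compose2[where t="{0..}" and f="max 0"])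
    show "continuous_on {0..} (\<lambda>u. integral {0..u} (h y))"
      using der by (auto intro!: has_vector_derivative_continuous simp: continuous_on_eq_continuous_within)
  qed (auto intro!: continuous_intros)
  then have contT: "continuous_on UNIV (T y)" for y
    unfolding T_def by (intro continuous_intros)
  have boundT: "norm (T y t) \<le> norm x0 + (norm (F 0) + L * norm y) / k" for y t
  proof -
    define t' where "t' = max 0 t"
    have "exp (- k * t') * norm (integral {0..t'} (h y)) \<le> (norm (F 0) + L * norm y) / k"
    proof (rule norm_integral_le_exp)
      fix s assume s: "s \<in> {0..t'}"
      \<comment> \<open>A Lipschitz field grows at most affinely; comparison with \<open>F 0\<close>
        makes this explicit.\<close>
      have "norm (h y s) \<le> norm (F 0) + norm (h y s - F 0)"
        using norm_triangle_ineq[of "F 0" "h y s - F 0"] by simp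
      also have "norm (h y s - F 0) \<le> L * norm (exp (k * s) *\<^sub>R apply_bcontfun y s - 0)"
        unfolding h_def by (rule lipschitz_on_normD[OF lip]) auto
      also have "\<dots> = L * norm (apply_bcontfun y s) * exp (k * s)" by simp
      also have "\<dots> \<le> L * norm y * exp (k * s)"
        using L by (intro mult_right_mono mult_left_mono norm_bounded) auto
      also have "norm (F 0) \<le> norm (F 0) * exp (k * s)"
        using s k by (auto simp: mult_le_cancel_left1)
      finally show "norm (h y s) \<le> (norm (F 0) + L * norm y) * exp (k * s)"
        by (simp add: algebra_simps)
    qed (use L k inth in \<open>auto simp: t'_def\<close>)
    moreover have "exp (- k * t') * norm x0 \<le> norm x0"
      using k by (intro mult_left_le_one_le) (auto simp: t'_def)
    moreover have "norm (T y t) \<le> exp (- k * t') * (norm x0 + norm (integral {0..t'} (h y)))"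
      unfolding T_def t'_def[symmetric] norm_scaleR
      by (simp add: norm_triangle_ineq)
    ultimately show ?thesis by (simp add: algebra_simps)
  qed
  have T_in: "T y \<in> bcontfun" for y
    using contT boundT by (rule bcontfun_normI)
  have "dist (Bcontfun (T y)) (Bcontfun (T z)) \<le> L / k * dist y z" for y z
  proof (rule dist_bound)
    fix t :: real
    define t' where "t' = max 0 t"
    have "dist (T y t) (T z t) = exp (- k * t') * norm (integral {0..t'} (\<lambda>s. h y s - h z s))"
      unfolding T_def t'_def[symmetric] dist_norm
      by (simp add: integral_diff inth flip: scaleR_diff_right)
    also have "\<dots> \<le> L * dist y z / k"
    proof (rule norm_integral_le_exp)
      fix s assume s: "s \<in> {0..t'}"
      have "norm (h y s - h z s)
          \<le> L * norm (exp (k * s) *\<^sub>R apply_bcontfun y s - exp (k * s) *\<^sub>R apply_bcontfun z s)"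
        unfolding h_def by (rule lipschitz_on_normD[OF lip]) auto
      also have "\<dots> = L * dist (apply_bcontfun y s) (apply_bcontfun z s) * exp (k * s)"
        by (simp add: dist_norm flip: scaleR_diff_right)
      also have "\<dots> \<le> L * dist y z * exp (k * s)"
        using L by (intro mult_right_mono mult_left_mono dist_bounded) auto
      finally show "norm (h y s - h z s) \<le> L * dist y z * exp (k * s)" .
    qed (use L k inth in \<open>auto simp: t'_def intro!: integrable_diff\<close>)
    finally show "dist (apply_bcontfun (Bcontfun (T y)) t) (apply_bcontfun (Bcontfun (T z)) t)
        \<le> L / k * dist y z"
      by (simp add: Bcontfun_inverse T_in)
  qed
  then obtain y where "Bcontfun (T y) = y"
    using banach_fix_type[of "L / k" "\<lambda>y. Bcontfun (T y)"] k by auto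
  then have y: "apply_bcontfun y t = T y t" for t
    by (metis Bcontfun_inverse T_in)
  \<comment> \<open>Undoing the weight in the fixed point equation gives this integral for
    \<open>t \<ge> 0\<close>; in this form the derivative can be read off.\<close>
  define x where "x t = x0 + integral {0..t} (h y)" for t
  have x: "exp (k * t) *\<^sub>R apply_bcontfun y t = x t" if "t \<ge> 0" for t
    using that by (simp add: y T_def x_def flip: exp_add)
  show ?thesis
  proof
    show "x 0 = x0" by (simp add: x_def)
  next
    fix t :: real assume t: "t \<ge> 0"
    have "(x has_vector_derivative h y t) (at t within {0..})"
      unfolding x_def using der[OF t, of y] by (auto intro!: derivative_eq_intros)
    then show "(x has_vector_derivative F (x t)) (at t within {0..})"
      by (simp add: h_def x[OF t])
  qed
qed

section \<open>Monotone distance to a point, and projection onto a ball\<close>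

lemma norm_diff_nonincreasing:
  fixes x :: "real \<Rightarrow> 'a::real_inner"
  assumes "is_interval J" and "0 \<in> J" and "t \<in> J" and "0 \<le> t"
    and der: "\<And>s. s \<in> J \<Longrightarrow> (x has_vector_derivative x' s) (at s within J)"
    and neg: "\<And>s. s \<in> J \<Longrightarrow> (x s - a) \<bullet> x' s \<le> 0"
  shows "norm (x t - a) \<le> norm (x 0 - a)"
proof -
  have sub: "{0..t} \<subseteq> J"
    using mem_is_interval_1_I[OF assms(1-3)] by auto
  \<comment> \<open>The squared distance stays differentiable where \<open>x s = a\<close>, so the
    mean value theorem applies throughout.\<close>
  define \<phi> where "\<phi> s = (x s - a) \<bullet> (x s - a)" for s
  have "(\<phi> has_derivative (\<lambda>h. h * (2 * ((x s - a) \<bullet> x' s)))) (at s within {0..t})"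
    if "0 \<le> s" "s \<le> t" for s
  proof -
    have "(x has_derivative (\<lambda>h. h *\<^sub>R x' s)) (at s within {0..t})"
      using has_vector_derivative_within_subset[OF der[of s] sub] sub that
      by (auto simp: has_vector_derivative_def)
    then show ?thesis
      unfolding \<phi>_def by (auto intro!: derivative_eq_intros simp: inner_commute)
  qed
  from mvt_very_simple[OF \<open>0 \<le> t\<close> this] obtain s where
    "s \<in> {0..t}" and "\<phi> t - \<phi> 0 = (t - 0) * (2 * ((x s - a) \<bullet> x' s))" by blast
  then have "\<phi> t - \<phi> 0 \<le> 0"
    using neg[of s] sub \<open>0 \<le> t\<close> by (auto intro!: mult_nonneg_nonpos)
  then show ?thesis by (simp add: \<phi>_def norm_le)
qed

text \<open>The projection is radial: \<open>c = 1\<close> inside the ball and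
  \<open>c = r / norm (x - a)\<close> outside. Positivity of \<open>c\<close> lets the sign of an
  inner product with \<open>x - a\<close> be read off at the projected point.\<close>

lemma closest_point_cball:
  fixes a x :: "'a::euclidean_space"
  assumes "0 < r"
  obtains c where "0 < c" and "closest_point (cball a r) x - a = c *\<^sub>R (x - a)"
proof (cases "x \<in> cball a r")
  case True
  then show ?thesis using that[of 1] by (simp add: closest_point_self)
next
  case False
  define c where "c = r / norm (x - a)"
  have n: "r < norm (x - a)" using False by (auto simp: dist_norm norm_minus_commute)
  have c: "0 < c" "c < 1" using assms n by (auto simp: c_def divide_less_eq intro!: divide_pos_pos)
  have cn: "c * norm (x - a) = r" using n assms by (auto simp: c_def)
  have "a + c *\<^sub>R (x - a) = closest_point (cball a r) x"
  proof (rule closest_point_unique)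
    show "a + c *\<^sub>R (x - a) \<in> cball a r" using c cn by (simp add: dist_norm)
    have "dist x (a + c *\<^sub>R (x - a)) = norm ((1 - c) *\<^sub>R (x - a))"
      by (simp add: dist_norm algebra_simps)
    also have "\<dots> = norm (x - a) - r"
      unfolding norm_scaleR using c cn by (simp add: left_diff_distrib)
    finally have *: "dist x (a + c *\<^sub>R (x - a)) = norm (x - a) - r" .
    show "\<forall>z\<in>cball a r. dist x (a + c *\<^sub>R (x - a)) \<le> dist x z"
    proof
      fix z assume "z \<in> cball a r"
      then show "dist x (a + c *\<^sub>R (x - a)) \<le> dist x z"
        unfolding * using dist_triangle[of x a z] by (simp add: dist_norm norm_minus_commute)
    qed
  qed auto
  then show ?thesis using that[of c] c by (metis add_diff_cancel_left')
qed

section \<open>The stacked vector field and its direction relative to the target\<close>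

definition bearing_field ::
  "('n::finite \<times> 'n) set \<Rightarrow> ('n \<Rightarrow> 'n \<Rightarrow> real ^ 'd) \<Rightarrow> (real ^ 'd) ^ 'n \<Rightarrow> (real ^ 'd) ^ 'n" where
  "bearing_field E gs p = (\<chi> i. - (\<Sum>j\<in>E `` {i}. orth_proj (bearing p i j) *v gs i j))"

lemma orth_proj_mult:
  fixes x y :: "real ^ 'd"
  shows "orth_proj x *v y = y - ((x \<bullet> y) / (norm x)\<^sup>2) *\<^sub>R x"
proof -
  have "((columnvector x :: real ^ 1 ^ 'd) ** (rowvector x :: real ^ 'd ^ 1)) *v y = (x \<bullet> y) *\<^sub>R x"
    by (simp add: vec_eq_iff matrix_vector_mult_def matrix_matrix_mult_def columnvector_def
        rowvector_def inner_vec_def sum_distrib_left mult_ac)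
  then show ?thesis
    by (simp add: orth_proj_def matrix_vector_mult_diff_rdistrib flip: scaleR_matrix_vector_assoc)
qed

lemma bearing_flip: "bearing p j i = - bearing p i j"
  unfolding bearing_def by (metis minus_diff_eq norm_minus_commute scaleR_minus_right)

lemma norm_bearing: "p $ i \<noteq> p $ j \<Longrightarrow> norm (bearing p i j) = 1"
  by (simp add: bearing_def)

lemma scaleR_bearing: "norm (p $ j - p $ i) *\<^sub>R bearing p i j = p $ j - p $ i"
  by (cases "p $ j = p $ i") (auto simp: bearing_def)

text \<open>Reversing every edge turns \<open>q i \<bullet> A i j\<close> into
  \<open>- (q j \<bullet> A i j)\<close>; averaging the two forms of the sum gives the difference
  and the factor 1/2.\<close>

lemma sum_antisymmetric_edges:
  fixes A :: "'n::finite \<Rightarrow> 'n \<Rightarrow> 'a::real_inner"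
  assumes "sym E" and A: "\<And>i j. (i, j) \<in> E \<Longrightarrow> A j i = - A i j"
  shows "(\<Sum>i\<in>UNIV. q i \<bullet> (\<Sum>j\<in>E `` {i}. A i j)) = (\<Sum>(i, j)\<in>E. (q i - q j) \<bullet> A i j) / 2"
proof -
  have "E = Sigma UNIV (\<lambda>i. E `` {i})" by auto
  then have "(\<Sum>i\<in>UNIV. q i \<bullet> (\<Sum>j\<in>E `` {i}. A i j)) = (\<Sum>(i, j)\<in>E. q i \<bullet> A i j)"
    unfolding inner_sum_right by (subst sum.Sigma) auto
  moreover have "(\<Sum>(i, j)\<in>E. q i \<bullet> A i j) = (\<Sum>(i, j)\<in>E. - (q j \<bullet> A i j))"
    using assms by (intro sum.reindex_bij_witness[of _ prod.swap prod.swap]) (auto dest: symD)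
  ultimately show ?thesis
    by (simp add: inner_diff_left sum_subtractf sum_negf split_def)
qed

lemma bearing_field_inward:
  assumes "sym E" and gs: "bearing_constraints E gs" and q: "satisfies_bearings E gs q"
    and p: "\<And>i j. (i, j) \<in> E \<Longrightarrow> p $ i \<noteq> p $ j"
  shows "(p - q) \<bullet> bearing_field E gs p \<le> 0"
proof -
  define A where "A i j = orth_proj (bearing p i j) *v gs i j" for i j
  have edge: "0 \<le> ((p - q) $ i - (p - q) $ j) \<bullet> A i j" if ij: "(i, j) \<in> E" for i j
  proof -
    define g where "g = bearing p i j"
    define h where "h = gs i j"
    have g: "norm g = 1" using p[OF ij] by (simp add: g_def norm_bearing)
    have h: "norm h = 1" and hq: "bearing q i j = h"
      using gs q ij by (auto simp: bearing_constraints_def satisfies_bearings_def h_def)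
    have A: "A i j = h - (g \<bullet> h) *\<^sub>R g"
      unfolding A_def orth_proj_mult using g by (simp add: g_def h_def)
    \<comment> \<open>This is the edge vector of \<open>q\<close> minus that of \<open>p\<close>.
      The latter is orthogonal to \<open>A i j\<close>, so only the nonnegative multiple of
      \<open>h \<bullet> A i j\<close> survives.\<close>
    have e: "(p - q) $ i - (p - q) $ j = norm (q $ j - q $ i) *\<^sub>R h - norm (p $ j - p $ i) *\<^sub>R g"
      using scaleR_bearing[of p j i] scaleR_bearing[of q j i] by (simp add: g_def hq)
    have "g \<bullet> A i j = 0" and "h \<bullet> A i j = 1 - (g \<bullet> h)\<^sup>2"
      using g h by (simp_all add: A inner_diff_right norm_eq_1 power2_eq_square inner_commute)
    moreover have "(g \<bullet> h)\<^sup>2 \<le> 1"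
      using Cauchy_Schwarz_ineq2[of g h] g h by (simp add: abs_square_le_1)
    ultimately show ?thesis unfolding e by (simp add: inner_diff_left)
  qed
  \<comment> \<open>The projection is quadratic in the bearing, hence blind to its sign; only the
    constraint vector flips.\<close>
  have anti: "A j i = - A i j" if "(i, j) \<in> E" for i j
  proof -
    have "gs j i = - gs i j"
      using gs \<open>sym E\<close> that by (auto simp: bearing_constraints_def dest: symD)
    then show ?thesis
      by (simp add: A_def orth_proj_mult bearing_flip[of p j i])
  qed
  have "(p - q) \<bullet> bearing_field E gs p = - (\<Sum>i\<in>UNIV. (p - q) $ i \<bullet> (\<Sum>j\<in>E `` {i}. A i j))"
    by (simp add: inner_vec_def bearing_field_def A_def sum_negf)
  also have "\<dots> = - ((\<Sum>(i, j)\<in>E. ((p - q) $ i - (p - q) $ j) \<bullet> A i j) / 2)"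
    using sum_antisymmetric_edges[OF \<open>sym E\<close>, of A "\<lambda>i. (p - q) $ i"] anti by simp
  also have "\<dots> \<le> 0"
    using edge by (auto intro!: sum_nonneg)
  finally show ?thesis .
qed

section \<open>Separation of agents near the target\<close>

lemma norm_nth_diff_le:
  fixes x :: "('a::real_normed_vector) ^ 'n"
  assumes "i \<noteq> j"
  shows "norm (x $ i - x $ j) \<le> sqrt 2 * norm x"
proof -
  have "norm (x $ i - x $ j) \<le> norm (x $ i) + norm (x $ j)" by (rule norm_triangle_ineq4)
  then have "(norm (x $ i - x $ j))\<^sup>2 \<le> (norm (x $ i) + norm (x $ j))\<^sup>2" by (rule power_mono) simp
  also have "\<dots> \<le> 2 * ((norm (x $ i))\<^sup>2 + (norm (x $ j))\<^sup>2)"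
    using sum_squares_bound[of "norm (x $ i)" "norm (x $ j)"] by (simp add: power2_sum)
  also have "(norm (x $ i))\<^sup>2 + (norm (x $ j))\<^sup>2 = (\<Sum>k\<in>{i, j}. (norm (x $ k))\<^sup>2)"
    using assms by simp
  also have "\<dots> \<le> (\<Sum>k\<in>UNIV. (norm (x $ k))\<^sup>2)"
    by (intro sum_mono2) auto
  also have "\<dots> = (norm x)\<^sup>2"
    by (simp add: norm_vec_def L2_set_def sum_nonneg)
  finally have "norm (x $ i - x $ j) \<le> sqrt (2 * (norm x)\<^sup>2)" by (intro real_le_rsqrt) simp
  then show ?thesis by (simp add: real_sqrt_mult)
qed

lemma min_separation_le:
  fixes p :: "(real ^ 'd) ^ 'n"
  assumes "i \<noteq> j"
  shows "min_separation p \<le> norm (p $ i - p $ j)"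
  unfolding min_separation_def
proof (rule Min_le)
  show "finite {norm (p $ i - p $ j) | i j. i \<noteq> j}"
    by (rule finite_subset[of _ "(\<lambda>(i, j). norm (p $ i - p $ j)) ` UNIV"]) auto
qed (use assms in auto)

lemma separation_perturbed:
  fixes p q :: "(real ^ 'd) ^ 'n"
  assumes "i \<noteq> j" and "2 \<le> CARD('n)"
  shows "min_separation q - sqrt (real CARD('n)) * norm (p - q) \<le> norm (p $ i - p $ j)"
proof -
  have "norm (q $ i - q $ j) \<le> norm (p $ i - p $ j) + norm ((p - q) $ i - (p - q) $ j)"
    using norm_triangle_ineq4[of "p $ i - p $ j" "(p - q) $ i - (p - q) $ j"] by simp
  moreover have "norm ((p - q) $ i - (p - q) $ j) \<le> sqrt 2 * norm (p - q)"
    using assms(1) by (rule norm_nth_diff_le)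
  \<comment> \<open>With at least two agents the sharper constant \<open>sqrt 2\<close> can be
    weakened to the \<open>sqrt n\<close> of the hypothesis.\<close>
  moreover have "sqrt 2 * norm (p - q) \<le> sqrt (real CARD('n)) * norm (p - q)"
    using assms(2) by (intro mult_right_mono) auto
  ultimately show ?thesis
    using min_separation_le[OF assms(1), of q] by linarith
qed

section \<open>Lipschitz continuity of the field where neighbours stay apart\<close>

lemma norm_normalized_diff_le:
  fixes u v :: "'a::real_normed_vector"
  assumes "0 < c" and "c \<le> norm u" and "c \<le> norm v"
  shows "norm (u /\<^sub>R norm u - v /\<^sub>R norm v) \<le> 2 / c * norm (u - v)"
proof -
  have pos: "0 < norm u" "0 < norm v" using assms by linarith+
  \<comment> \<open>First the vector changes with its normalizing factor fixed, then the factor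
    changes; each change costs at most \<open>norm (u - v) / c\<close>.\<close>
  have *: "u /\<^sub>R norm u - v /\<^sub>R norm v
      = (u - v) /\<^sub>R norm u + ((norm v - norm u) / (norm u * norm v)) *\<^sub>R v"
    using assms
    by (cases "u = 0"; cases "v = 0")
      (auto simp: scaleR_diff_right diff_divide_distrib scaleR_diff_left inverse_eq_divide)
  have "norm (u /\<^sub>R norm u - v /\<^sub>R norm v)
      \<le> norm ((u - v) /\<^sub>R norm u) + norm (((norm v - norm u) / (norm u * norm v)) *\<^sub>R v)"
    unfolding * by (rule norm_triangle_ineq)
  also have "\<dots> = (norm (u - v) + \<bar>norm v - norm u\<bar>) / norm u"
    using pos unfolding norm_scaleR abs_divide abs_mult by (simp add: field_simps)
  also have "\<dots> \<le> (norm (u - v) + norm (u - v)) / c"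
    using assms norm_triangle_ineq3[of v u]
    by (intro frac_le add_mono) (auto simp: norm_minus_commute)
  finally show ?thesis by simp
qed

text \<open>The expression is quadratic in the unit vector, so exchanging one factor at a time gives
  two equal contributions.\<close>

lemma norm_inner_scaleR_diff_le:
  fixes g h w :: "'a::real_inner"
  assumes "norm g \<le> 1" and "norm h \<le> 1"
  shows "norm ((g \<bullet> w) *\<^sub>R g - (h \<bullet> w) *\<^sub>R h) \<le> 2 * norm w * norm (g - h)"
proof -
  have "(g \<bullet> w) *\<^sub>R g - (h \<bullet> w) *\<^sub>R h = (g \<bullet> w) *\<^sub>R (g - h) + ((g - h) \<bullet> w) *\<^sub>R h"
    by (simp add: inner_diff_left algebra_simps)
  then have "norm ((g \<bullet> w) *\<^sub>R g - (h \<bullet> w) *\<^sub>R h)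
      \<le> \<bar>g \<bullet> w\<bar> * norm (g - h) + \<bar>(g - h) \<bullet> w\<bar> * norm h"
    using norm_triangle_ineq[of "(g \<bullet> w) *\<^sub>R (g - h)" "((g - h) \<bullet> w) *\<^sub>R h"] by simp
  also have "\<dots> \<le> (1 * norm w) * norm (g - h) + (norm (g - h) * norm w) * 1"
    using assms Cauchy_Schwarz_ineq2[of g w] Cauchy_Schwarz_ineq2[of "g - h" w]
      mult_right_mono[of "norm g" 1 "norm w"]
    by (intro add_mono mult_mono) auto
  finally show ?thesis by (simp add: algebra_simps)
qed

lemma bearing_field_lipschitz:
  assumes gs: "bearing_constraints E gs" and "0 < c"
    and sep: "\<And>p i j. p \<in> S \<Longrightarrow> (i, j) \<in> E \<Longrightarrow> c \<le> norm (p $ j - p $ i)"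
  obtains L where "L-lipschitz_on S (bearing_field E gs)"
proof
  define A where "A p i j = orth_proj (bearing p i j) *v gs i j" for p i j
  \<comment> \<open>The constant is a product: 2 from the projection, \<open>2 / c\<close> from
    normalizing, 2 from the two endpoints of the edge.\<close>
  have edge: "norm (A p i j - A q i j) \<le> 8 / c * norm (p - q)"
    if "p \<in> S" "q \<in> S" "(i, j) \<in> E" for p q i j
  proof -
    have cp: "c \<le> norm (p $ j - p $ i)" and cq: "c \<le> norm (q $ j - q $ i)"
      using sep that by auto
    then have "norm (bearing p i j) = 1" "norm (bearing q i j) = 1"
      using \<open>0 < c\<close> by (auto intro!: norm_bearing)
    then have unit: "norm (bearing p i j) \<le> 1" "norm (bearing q i j) \<le> 1"
      and "norm (A p i j - A q i j)
        = norm ((bearing p i j \<bullet> gs i j) *\<^sub>R bearing p i j - (bearing q i j \<bullet> gs i j) *\<^sub>R bearing q i j)"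
      by (simp_all add: A_def orth_proj_mult norm_minus_commute)
    note this(3)
    also have "\<dots> \<le> 2 * norm (gs i j) * norm (bearing p i j - bearing q i j)"
      using unit by (rule norm_inner_scaleR_diff_le)
    also have "\<dots> \<le> 2 * (2 / c * norm ((p $ j - p $ i) - (q $ j - q $ i)))"
      using gs that(3) norm_normalized_diff_le[OF \<open>0 < c\<close> cp cq]
      by (auto simp: bearing_constraints_def bearing_def)
    also have "norm ((p $ j - p $ i) - (q $ j - q $ i)) \<le> norm ((p - q) $ j) + norm ((p - q) $ i)"
      using norm_triangle_ineq4[of "(p - q) $ j" "(p - q) $ i"] by (simp add: algebra_simps)
    also have "\<dots> \<le> norm (p - q) + norm (p - q)"
      by (intro add_mono Finite_Cartesian_Product.norm_nth_le)
    finally show ?thesis using \<open>0 < c\<close> by (simp add: mult_left_mono divide_right_mono)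
  qed
  show "(\<Sum>i\<in>UNIV. \<Sum>j\<in>E `` {i}. 8 / c)-lipschitz_on S (bearing_field E gs)"
  proof (rule lipschitz_onI)
    fix p q assume pq: "p \<in> S" "q \<in> S"
    have "dist (bearing_field E gs p) (bearing_field E gs q)
        \<le> (\<Sum>i\<in>UNIV. norm ((bearing_field E gs p - bearing_field E gs q) $ i))"
      unfolding dist_norm norm_vec_def by (rule L2_set_le_sum) simp
    also have "\<dots> = (\<Sum>i\<in>UNIV. norm (\<Sum>j\<in>E `` {i}. A p i j - A q i j))"
      by (simp add: bearing_field_def A_def sum_subtractf norm_minus_commute)
    also have "\<dots> \<le> (\<Sum>i\<in>UNIV. \<Sum>j\<in>E `` {i}. 8 / c * norm (p - q))"
      using edge pq by (intro sum_mono sum_norm_le) auto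
    also have "\<dots> = (\<Sum>i\<in>UNIV. \<Sum>j\<in>E `` {i}. 8 / c) * dist p q"
      by (simp add: sum_distrib_right dist_norm mult.assoc)
    finally show "dist (bearing_field E gs p) (bearing_field E gs q)
        \<le> (\<Sum>i\<in>UNIV. \<Sum>j\<in>E `` {i}. 8 / c) * dist p q" .
  qed (use \<open>0 < c\<close> in \<open>simp add: sum_nonneg\<close>)
qed

text \<open>Solutions are specified agent by agent, whereas the distance argument differentiates the
  stacked configuration.\<close>

lemma has_vector_derivative_vec:
  fixes p :: "real \<Rightarrow> ('a::real_normed_vector) ^ 'n"
  assumes "\<And>i. ((\<lambda>t. p t $ i) has_vector_derivative p' $ i) (at t within J)"
  shows "(p has_vector_derivative p') (at t within J)"
  unfolding has_vector_derivative_def has_derivative_at_within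
proof
  show "bounded_linear (\<lambda>h. h *\<^sub>R p')" by (rule bounded_linear_scaleR_left)
  show "((\<lambda>y. ((p y - p t) - (y - t) *\<^sub>R p') /\<^sub>R norm (y - t)) \<longlongrightarrow> 0) (at t within J)"
  proof (rule vec_tendstoI)
    fix i
    show "((\<lambda>y. (((p y - p t) - (y - t) *\<^sub>R p') /\<^sub>R norm (y - t)) $ i) \<longlongrightarrow> 0 $ i) (at t within J)"
      using assms[of i] unfolding has_vector_derivative_def has_derivative_at_within
      by simp
  qed
qed

section \<open>A global solution, and separation along every solution\<close>

theorem theorem12:
  fixes E Or :: "('n::finite \<times> 'n) set"
    and gs :: "'n \<Rightarrow> 'n \<Rightarrow> real ^ ('d::finite)"
    and p0 ps :: "(real ^ 'd) ^ 'n"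
    and \<gamma> :: real
  assumes "CARD('n) \<ge> 2" and "CARD('d) \<ge> 2"
    and "sym E" and "irrefl E" and "orientation E Or"
    and "bearing_constraints E gs"
    and "feasible E gs"
    and "ensure_inf_bearing_rigidity E Or gs"
    and "formation_scale p0 > 0"
    and "target_configuration E gs p0 ps"
    and "0 \<le> \<gamma>" and "\<gamma> < min_separation ps"
    and "norm (p0 - ps) < (1 / sqrt (real CARD('n))) * (min_separation ps - \<gamma>)"
  shows "(\<exists>p. bearing_solution_on {0..} E gs p0 p) \<and>
    (\<forall>J p. is_interval J \<and> 0 \<in> J \<and> J \<subseteq> {0..} \<and> bearing_solution_on J E gs p0 p \<longrightarrow>
       (\<forall>t\<in>J. \<forall>i j. i \<noteq> j \<longrightarrow> norm (p t $ i - p t $ j) > \<gamma>))"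
proof -
  let ?m = "min_separation ps"
  let ?n = "real CARD('n)"
  have tgt: "satisfies_bearings E gs ps"
    using assms(10) by (simp add: target_configuration_def)
  have n: "0 < sqrt ?n" by simp
  have close: "sqrt ?n * norm (p0 - ps) < ?m - \<gamma>"
    using assms(13) n by (simp add: field_simps)
  then have "norm (p0 - ps) < ?m / sqrt ?n"
    using n \<open>0 \<le> \<gamma>\<close> by (simp add: field_simps)
  \<comment> \<open>The lower bound puts \<open>p0\<close> inside the ball and makes
    \<open>r\<close> positive even if \<open>p0 = ps\<close>; the upper bound makes the separation
    \<open>c\<close> on the ball positive.\<close>
  then obtain r where r: "norm (p0 - ps) < r" "r < ?m / sqrt ?n"
    using dense by blast
  then have r0: "0 < r" using norm_ge_zero[of "p0 - ps"] by linarith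
  define c where "c = ?m - sqrt ?n * r"
  have c: "0 < c" using r(2) n by (simp add: c_def field_simps)
  let ?K = "cball ps r"
  have sep: "c \<le> norm (p $ j - p $ i)" if "p \<in> ?K" "(i, j) \<in> E" for p i j
  proof -
    have "j \<noteq> i" using that(2) \<open>irrefl E\<close> by (auto simp: irrefl_def)
    then have "?m - sqrt ?n * norm (p - ps) \<le> norm (p $ j - p $ i)"
      using assms(1) by (rule separation_perturbed)
    moreover have "sqrt ?n * norm (p - ps) \<le> sqrt ?n * r"
      using that(1) by (intro mult_left_mono) (auto simp: dist_norm norm_minus_commute)
    ultimately show ?thesis unfolding c_def by linarith
  qed
  let ?\<pi> = "closest_point ?K"
  have \<pi>: "?\<pi> p \<in> ?K" for p
    using r0 by (intro closest_point_in_set) auto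
  obtain L where L: "L-lipschitz_on ?K (bearing_field E gs)"
    using bearing_field_lipschitz[OF assms(6) c sep] by blast
  have "1-lipschitz_on UNIV ?\<pi>"
    using r0 closest_point_lipschitz[of ?K] by (intro lipschitz_onI) auto
  then have "(L * 1)-lipschitz_on UNIV (\<lambda>p. bearing_field E gs (?\<pi> p))"
    using \<pi> by (intro lipschitz_on_compose2 lipschitz_on_subset[OF L]) auto
  then obtain x where x0: "x 0 = p0" and x:
    "\<And>t. t \<ge> 0 \<Longrightarrow> (x has_vector_derivative bearing_field E gs (?\<pi> (x t))) (at t within {0..})"
    using global_solution_of_lipschitz_field[where ?x0.0 = p0] by blast
  \<comment> \<open>At \<open>?\<pi> p\<close> neighbours are apart, so the inward estimate holds
    there; \<open>p - ps\<close> is a positive multiple of \<open>?\<pi> p - ps\<close>.\<close>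
  have inward: "(p - ps) \<bullet> bearing_field E gs (?\<pi> p) \<le> 0" for p
  proof -
    obtain k where k: "0 < k" "?\<pi> p - ps = k *\<^sub>R (p - ps)"
      using closest_point_cball[OF r0] by blast
    have "?\<pi> p $ i \<noteq> ?\<pi> p $ j" if "(i, j) \<in> E" for i j
      using sep[OF \<pi> that, of p] c by auto
    then have "(?\<pi> p - ps) \<bullet> bearing_field E gs (?\<pi> p) \<le> 0"
      by (intro bearing_field_inward assms tgt)
    then show ?thesis using k by (simp add: mult_le_0_iff)
  qed
  \<comment> \<open>Inside the ball \<open>?\<pi>\<close> is the identity, so the modified equation
    becomes the original one along \<open>x\<close>.\<close>
  have xK: "x t \<in> ?K" if "t \<ge> 0" for t
  proof -
    have "norm (x t - ps) \<le> norm (x 0 - ps)"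
      by (rule norm_diff_nonincreasing[where J = "{0..}"]) (use that x inward in auto)
    then show ?thesis using r(1) by (simp add: x0 dist_norm norm_minus_commute)
  qed
  have "bearing_solution_on {0..} E gs p0 x"
    unfolding bearing_solution_on_def
  proof (intro conjI ballI allI)
    fix t :: real and i assume t: "t \<in> {0..}"
    have "((\<lambda>t. x t $ i) has_vector_derivative bearing_field E gs (x t) $ i) (at t within {0..})"
      using x[of t] xK[of t] t
      by (auto intro!: bounded_linear.has_vector_derivative[OF bounded_linear_vec_nth]
          simp: closest_point_self)
    then show "((\<lambda>t. x t $ i) has_vector_derivative
        - (\<Sum>j\<in>E `` {i}. orth_proj (bearing (x t) i j) *v gs i j)) (at t within {0..})"
      by (simp add: bearing_field_def)
  next
    fix t e assume t: "t \<in> {0::real..}" and e: "e \<in> E"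
    then show "case e of (i, j) \<Rightarrow> x t $ i \<noteq> x t $ j"
      using sep[of "x t" "fst e" "snd e"] xK[of t] c by (auto split: prod.split)
  qed (rule x0)
  moreover have "\<gamma> < norm (p t $ i - p t $ j)"
    if J: "is_interval J" "0 \<in> J" "J \<subseteq> {0..}" and p: "bearing_solution_on J E gs p0 p"
      and t: "t \<in> J" and ij: "i \<noteq> j" for J p t i j
  proof -
    \<comment> \<open>An arbitrary solution keeps neighbours apart by definition, so the inward
      estimate applies to the original field at every time in \<open>J\<close>.\<close>
    have "norm (p t - ps) \<le> norm (p 0 - ps)"
    proof (rule norm_diff_nonincreasing[OF J(1,2) t])
      show "0 \<le> t" using J t by auto
    next
      fix s assume s: "s \<in> J"
      show "(p has_vector_derivative bearing_field E gs (p s)) (at s within J)"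
        by (rule has_vector_derivative_vec)
          (use p s in \<open>simp add: bearing_solution_on_def bearing_field_def\<close>)
      show "(p s - ps) \<bullet> bearing_field E gs (p s) \<le> 0"
        using p s by (intro bearing_field_inward assms tgt) (auto simp: bearing_solution_on_def)
    qed
    then have "sqrt ?n * norm (p t - ps) \<le> sqrt ?n * norm (p0 - ps)"
      using p by (intro mult_left_mono) (auto simp: bearing_solution_on_def)
    then show ?thesis
      using separation_perturbed[OF ij assms(1), of ps "p t"] close by linarith
  qed
  ultimately show ?thesis by blast
qed

end
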